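(* Let $d\ge2$ and $n\ge2d$ be integers, and let $\mathfrak{M}_{d,k}^{(n)}$, $\mathfrak{M}_d^{(n)}$ and the weights $W_q$ ($0<q<1$) be as defined in the context. For any function $g\colon\mathfrak{M}_d^{(n)}\to\mathbb{R}$ we have, as $q\to0^+$, $$\sum_{k=1}^d\ \sum_{(\mu^{(1)},\ldots,\mu^{(k)})\in\mathfrak{M}_{d,k}^{(n)}}g\big(\mu^{(1)},\ldots,\mu^{(k)}\big)\,W_q\big(\mu^{(1)},\ldots,\mu^{(k)}\big) = q^d\sum_{\ell^*(\mu^{(1)})=d}g\big(\mu^{(1)}\big)+q^{d+1}\sum_{\substack{\ell^*(\mu^{(1)})=d-1\\ \ell^*(\mu^{(2)})=1}}g\big(\mu^{(1)},\mu^{(2)}\big)+O\big(q^{d+2}\big),$$ where on the right-hand side $\mu^{(1)}$ and $\mu^{(2)}$ range over partitions of $n$ with the indicated colengths.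
   Context: $\mathcal{P}_n$ is the set of integer partitions of $n$. For a partition $\mu$, $|\mu|$ is its weight, $\ell(\mu)$ its number of parts, and $\ell^*(\mu):=|\mu|-\ell(\mu)$ its colength. For $k\in\{1,\ldots,d\}$, $\mathfrak{M}_{d,k}^{(n)}$ is the set of all $k$-tuples $(\mu^{(1)},\ldots,\mu^{(k)})\in(\mathcal{P}_n)^k$ with $\ell^*(\mu^{(j)})\ne0$ for all $j$ and $\sum_{j=1}^k\ell^*(\mu^{(j)})=d$; and $\mathfrak{M}_d^{(n)}:=\coprod_{k=1}^d\mathfrak{M}_{d,k}^{(n)}$. For a tuple $(\mu^{(1)},\ldots,\mu^{(k)})\in\mathfrak{M}_{d,k}^{(n)}$, let $\lambda$ be the partition of $d$ whose parts are the colengths $\ell^*(\mu^{(1)}),\ldots,\ell^*(\mu^{(k)})$ in weakly decreasing order, and $|\mathrm{aut}(\lambda)|:=\prod_{i\ge1}m_i(\lambda)!$ with $m_i(\lambda)$ the number of parts of $\lambda$ equal to $i$. The weight is $$W_q(\mu^{(1)},\ldots,\mu^{(k)}):=\frac{1}{|\mathrm{aut}(\lambda)|}\sum_{\sigma\in S_k}\ \prod_{j=1}^{k}\frac{1}{q^{-\sum_{i=1}^{j}\ell^*(\mu^{(\sigma(i))})}-1}$$ (equivalently, the monomial symmetric function $m_\lambda$ evaluated at $(q,q^2,q^3,\ldots)$).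
   Formalization: The left-hand sum runs only over tuples with weakly decreasing colengths; over all ordered tuples the claim fails for d≥3 (e.g. d=3, n=6, g=1: the q^4 coefficient is 4 on the left, 2 on the right), since W_q already sums over rearrangements. *)

theory Defs
  imports
    Complex_Main
    "HOL-Library.Multiset"
    "HOL-Library.Landau_Symbols"
    "HOL-Combinatorics.Permutations"
begin

text \<open>An integer partition is the multiset of its parts.\<close>

definition partitions :: "nat \<Rightarrow> nat multiset set" where
  "partitions n = {\<mu>. 0 \<notin># \<mu> \<and> sum_mset \<mu> = n}"

text \<open>The subtraction does not truncate when all parts are positive.\<close>

definition colength :: "nat multiset \<Rightarrow> nat" where
  "colength \<mu> = sum_mset \<mu> - size \<mu>"

text \<open>A tuple of partitions is a list, so that the coproduct over \<open>k\<close> of the sets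
  \<open>tuples n d k\<close> is simply their (disjoint) union.\<close>

definition tuples :: "nat \<Rightarrow> nat \<Rightarrow> nat \<Rightarrow> nat multiset list set" where
  "tuples n d k = {\<mu>s. length \<mu>s = k \<and> set \<mu>s \<subseteq> partitions n \<and>
     (\<forall>\<mu>\<in>set \<mu>s. colength \<mu> \<noteq> 0) \<and> sum_list (map colength \<mu>s) = d}"

text \<open>The weight of a tuple is the monomial symmetric function \<open>m\<^sub>\<lambda>(q, q\<^sup>2, \<dots>)\<close>, where
  \<open>\<lambda>\<close> is the partition formed by the colengths. It already accounts for all distinct
  rearrangements of \<open>\<lambda>\<close>. A sum of these weights must therefore run over tuples listed by
  weakly decreasing colength; running over all rearrangements would count
  such tuples several times.\<close>

definition colength_decreasing :: "nat multiset list \<Rightarrow> bool" where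
  "colength_decreasing \<mu>s \<longleftrightarrow> sorted_wrt (\<ge>) (map colength \<mu>s)"

definition aut_card :: "nat multiset \<Rightarrow> nat" where
  "aut_card p = (\<Prod>i\<in>set_mset p. fact (count p i))"

definition weight :: "real \<Rightarrow> nat multiset list \<Rightarrow> real" where
  "weight q \<mu>s =
     1 / real (aut_card (mset (map colength \<mu>s))) *
     (\<Sum>\<sigma> | \<sigma> permutes {..<length \<mu>s}.
        \<Prod>j<length \<mu>s. 1 / (q powi (- int (\<Sum>i\<le>j. colength (\<mu>s ! \<sigma> i))) - 1))"

end

theory Submission
  imports Defs
begin

text \<open>Each factor \<open>1 / (q\<^sup>-\<^sup>s - 1)\<close> equals \<open>q\<^sup>s + O(q\<^sup>2\<^sup>s)\<close>, so the summand of a weight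
  belonging to a rearrangement \<open>c\<^sub>1, \<dots>, c\<^sub>k\<close> of the colengths has order \<open>q\<close> to the power of the sum of the
  partial sums \<open>c\<^sub>1 + \<dots> + c\<^sub>j\<close>. The last partial sum is \<open>d\<close>; for \<open>k = 2\<close> the other one
  is 1 only for the rearrangement \<open>1, d - 1\<close>, and for \<open>k \<ge> 3\<close> the last but one is already at
  least 2. For \<open>d = 2\<close> two rearrangements coincide, which the factor \<open>1 / |aut|\<close> compensates.\<close>

text \<open>For \<open>0 < q < 1\<close> and \<open>s \<ge> 1\<close> this is the geometric series
  \<open>q ^ s + q ^ (2 * s) + ...\<close>. The body copies the factors of \<open>weight\<close>, so
  that these can be folded into it.\<close>

definition geom :: "nat \<Rightarrow> real \<Rightarrow> real" where
  "geom s q = 1 / (q powi (- int s) - 1)"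

lemma geom_eq:
  assumes "0 < q" "q < 1" "s \<ge> 1"
  shows "geom s q = q ^ s / (1 - q ^ s)"
proof -
  have "q ^ s < 1" using assms by (simp add: power_less_one_iff)
  moreover have "q ^ s > 0" using assms by simp
  ultimately show ?thesis
    using assms(1) by (simp add: geom_def power_int_minus field_simps)
qed

section \<open>Growth of the factors as \<open>q\<close> tends to 0 from the right\<close>

lemma eventually_unit_interval: "eventually (\<lambda>q::real. 0 < q \<and> q < 1) (at_right 0)"
  unfolding eventually_at_right_field by (intro exI[of _ 1]) auto

lemma power_bigo_at_right_0:
  assumes "m \<ge> k"
  shows "(\<lambda>q::real. q ^ m) \<in> O[at_right 0](\<lambda>q. q ^ k)"
proof (rule bigoI[of _ 1])
  show "eventually (\<lambda>q::real. norm (q ^ m) \<le> 1 * norm (q ^ k)) (at_right 0)"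
    using eventually_unit_interval assms
    by (auto elim!: eventually_mono intro: power_decreasing)
qed

lemma bigo_power_weaken:
  assumes "f \<in> O[at_right 0](\<lambda>q::real. q ^ m)" "m \<ge> k"
  shows "f \<in> O[at_right 0](\<lambda>q::real. q ^ k)"
  using landau_o.big.trans[OF assms(1) power_bigo_at_right_0[OF assms(2)]] .

text \<open>The quotient tends to 1, so the estimates of \<open>geom\<close> below reduce to the
  power in front of it.\<close>

lemma inverse_one_minus_power_bigo:
  assumes "s \<ge> 1"
  shows "(\<lambda>q::real. 1 / (1 - q ^ s)) \<in> O[at_right 0](\<lambda>_. 1)"
proof (rule bigoI_tendsto[of _ _ 1])
  have "((\<lambda>q::real. 1 / (1 - q ^ s) / 1) \<longlongrightarrow> 1 / (1 - 0 ^ s) / 1) (at_right 0)"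
    using assms by (intro tendsto_intros) (auto simp: zero_power)
  then show "((\<lambda>q::real. 1 / (1 - q ^ s) / 1) \<longlongrightarrow> 1) (at_right 0)"
    using assms by (simp add: zero_power)
qed simp

lemma geom_bigo:
  assumes "s \<ge> 1"
  shows "geom s \<in> O[at_right 0](\<lambda>q. q ^ s)"
proof -
  have "(\<lambda>q::real. q ^ s * (1 / (1 - q ^ s))) \<in> O[at_right 0](\<lambda>q. q ^ s * 1)"
    by (intro landau_o.big.mult inverse_one_minus_power_bigo assms) auto
  moreover have "eventually (\<lambda>q. geom s q = q ^ s * (1 / (1 - q ^ s))) (at_right 0)"
    using eventually_unit_interval by eventually_elim (use assms geom_eq in auto)
  ultimately show ?thesis by (subst landau_o.big.in_cong) auto
qed

text \<open>Without its first term the geometric series is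
  \<open>q ^ (2 * s) / (1 - q ^ s)\<close>.\<close>

lemma geom_minus_power_bigo:
  assumes "s \<ge> 1"
  shows "(\<lambda>q. geom s q - q ^ s) \<in> O[at_right 0](\<lambda>q. q ^ (2 * s))"
proof -
  have "(\<lambda>q::real. q ^ (2 * s) * (1 / (1 - q ^ s))) \<in> O[at_right 0](\<lambda>q. q ^ (2 * s) * 1)"
    by (intro landau_o.big.mult inverse_one_minus_power_bigo assms) auto
  moreover have "eventually (\<lambda>q. geom s q - q ^ s = q ^ (2 * s) * (1 / (1 - q ^ s))) (at_right 0)"
    using eventually_unit_interval
  proof eventually_elim
    case (elim q)
    then have "q ^ s < 1" using assms by (simp add: power_less_one_iff)
    with elim assms show ?case
      by (subst geom_eq) (auto simp: divide_simps right_diff_distrib mult_2 power_add)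
  qed
  ultimately show ?thesis by (subst landau_o.big.in_cong) auto
qed

lemma prod_geom_bigo:
  assumes "finite A" "\<And>j. j \<in> A \<Longrightarrow> s j \<ge> 1"
  shows "(\<lambda>q. \<Prod>j\<in>A. geom (s j) q) \<in> O[at_right 0](\<lambda>q. q ^ (\<Sum>j\<in>A. s j))"
  using assms
proof (induction A rule: finite_induct)
  case (insert x A)
  have "(\<lambda>q. geom (s x) q * (\<Prod>j\<in>A. geom (s j) q)) \<in> O[at_right 0](\<lambda>q. q ^ s x * q ^ (\<Sum>j\<in>A. s j))"
    by (intro landau_o.big.mult geom_bigo insert.IH insert.prems) auto
  with insert.hyps show ?case by (simp add: power_add)
qed simp

text \<open>This product comes from the rearrangement \<open>1, d - 1\<close>, whose partial sums
  are 1 and \<open>d\<close>. Replacing the factors by powers one at a time gives errors of order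
  \<open>2 + d\<close> and \<open>1 + 2 * d\<close>.\<close>

lemma geom_mult_geom_minus_power_bigo:
  assumes "d \<ge> 1"
  shows "(\<lambda>q. geom 1 q * geom d q - q ^ (d + 1)) \<in> O[at_right 0](\<lambda>q. q ^ (d + 2))"
proof -
  have "(\<lambda>q. (geom 1 q - q ^ 1) * geom d q) \<in> O[at_right 0](\<lambda>q. q ^ (2 * 1) * q ^ d)"
    by (intro landau_o.big.mult geom_minus_power_bigo geom_bigo assms order.refl)
  then have "(\<lambda>q. (geom 1 q - q ^ 1) * geom d q) \<in> O[at_right 0](\<lambda>q. q ^ (2 * 1 + d))"
    unfolding power_add .
  then have 1: "(\<lambda>q. (geom 1 q - q ^ 1) * geom d q) \<in> O[at_right 0](\<lambda>q. q ^ (d + 2))"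
    by (rule bigo_power_weaken) simp
  have "(\<lambda>q. q ^ 1 * (geom d q - q ^ d)) \<in> O[at_right 0](\<lambda>q. q ^ 1 * q ^ (2 * d))"
    by (intro landau_o.big.mult geom_minus_power_bigo assms landau_o.big_refl)
  then have "(\<lambda>q. q ^ 1 * (geom d q - q ^ d)) \<in> O[at_right 0](\<lambda>q. q ^ (1 + 2 * d))"
    unfolding power_add .
  then have 2: "(\<lambda>q. q ^ 1 * (geom d q - q ^ d)) \<in> O[at_right 0](\<lambda>q. q ^ (d + 2))"
    by (rule bigo_power_weaken) (use assms in simp)
  have "geom 1 q * geom d q - q ^ (d + 1)
      = (geom 1 q - q ^ 1) * geom d q + q ^ 1 * (geom d q - q ^ d)" for q
    by (simp add: algebra_simps)
  then show ?thesis
    by (simp only: sum_in_bigo(1)[OF 1 2])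
qed

section \<open>Finiteness of the index sets\<close>

lemma finite_partitions: "finite (partitions n)"
proof (rule finite_subset)
  show "partitions n \<subseteq> mset ` {xs. set xs \<subseteq> {..n} \<and> length xs \<le> n}"
  proof
    fix \<mu> assume "\<mu> \<in> partitions n"
    then have \<mu>: "0 \<notin># \<mu>" "sum_mset \<mu> = n" by (auto simp: partitions_def)
    obtain xs where xs: "\<mu> = mset xs" by (metis ex_mset)
    \<comment> \<open>All parts are positive, so their number is at most their sum
      \<open>n\<close>.\<close>
    have "sum_list (map (\<lambda>_. 1) xs) \<le> sum_list (map (\<lambda>x. x) xs)"
      using \<mu> xs by (intro sum_list_mono) (auto simp: Suc_le_eq intro: gr0I)
    then have "length xs \<le> n"
      using \<mu> xs by (simp add: sum_list_triv sum_mset_sum_list)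
    moreover have "set xs \<subseteq> {..n}"
      using \<mu> xs member_le_sum_list by (auto simp: sum_mset_sum_list)
    ultimately show "\<mu> \<in> mset ` {xs. set xs \<subseteq> {..n} \<and> length xs \<le> n}"
      using xs by auto
  qed
  show "finite (mset ` {xs. set xs \<subseteq> {..n} \<and> length xs \<le> n})"
    by (intro finite_imageI finite_lists_length_le) auto
qed

lemma finite_tuples: "finite (tuples n d k)"
  by (rule finite_subset[OF _ finite_lists_length_eq[OF finite_partitions[of n], of k]])
     (auto simp: tuples_def)

lemma length_tuples: "\<mu>s \<in> tuples n d k \<Longrightarrow> length \<mu>s = k"
  by (simp add: tuples_def)

section \<open>Weights of tuples with one or two entries\<close>

lemma weight_singleton: "weight q [\<mu>] = geom (colength \<mu>) q"
  by (simp add: weight_def aut_card_def lessThan_Suc geom_def)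

lemma permutes_lessThan_2: "{\<sigma>. \<sigma> permutes {..<2}} = {id, transpose 0 (1::nat)}"
proof -
  have "{..<2} = {0, 1::nat}" by auto
  then show ?thesis by (simp only: permutes_doubleton_iff) auto
qed

text \<open>The two permutations yield the partial sums \<open>a, a + b\<close> and
  \<open>b, a + b\<close>. If \<open>a = b\<close>, the summands agree and \<open>aut_card\<close>
  is 2, so one copy survives.\<close>

lemma weight_pair:
  fixes \<mu> \<nu> :: "nat multiset"
  defines "a \<equiv> colength \<mu>" and "b \<equiv> colength \<nu>"
  shows "weight q [\<mu>, \<nu>] =
    (if a = b then geom a q * geom (a + b) q
     else geom a q * geom (a + b) q + geom b q * geom (a + b) q)"
proof -
  have ne: "id \<noteq> transpose 0 (1::nat)"
    by (metis id_apply transpose_apply_first zero_neq_one)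
  have le: "{..0} = {0::nat}" "{..Suc 0} = {0, 1}" "{..<2} = {0, 1::nat}" by auto
  have "(\<Sum>\<sigma> | \<sigma> permutes {..<2}.
        \<Prod>j<2. 1 / (q powi (- int (\<Sum>i\<le>j. colength ([\<mu>, \<nu>] ! \<sigma> i))) - 1))
      = geom a q * geom (a + b) q + geom b q * geom (b + a) q"
    unfolding permutes_lessThan_2 using ne by (simp add: le a_def b_def geom_def)
  then show ?thesis
    by (simp add: weight_def aut_card_def add.commute a_def b_def numeral_2_eq_2[symmetric])
qed

section \<open>Weights of tuples with at least three entries\<close>

text \<open>The term \<open>j = k - 1\<close> is the full sum; the term \<open>j = k - 2\<close> has
  at least two summands, each at least 1.\<close>

lemma partial_sums_lower_bound:
  fixes s :: "nat \<Rightarrow> nat"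
  assumes "\<And>i. i < k \<Longrightarrow> s i \<ge> 1" "k \<ge> 3"
  shows "(\<Sum>i<k. s i) + 2 \<le> (\<Sum>j<k. \<Sum>i\<le>j. s i)"
proof -
  obtain m where k: "k = Suc (Suc m)" "m \<ge> 1"
    using assms(2) by (metis Suc_le_D Suc_le_mono numeral_3_eq_3 One_nat_def)
  have "(\<Sum>i\<le>m. 1) \<le> (\<Sum>i\<le>m. s i)"
    using assms(1) k by (intro sum_mono) auto
  then have "2 \<le> (\<Sum>i\<le>m. s i)" using k by simp
  also have "\<dots> \<le> (\<Sum>j\<le>m. \<Sum>i\<le>j. s i)"
    by (rule member_le_sum[of m "{..m}" "\<lambda>j. sum s {..j}"]) auto
  finally have "2 \<le> (\<Sum>j\<le>m. \<Sum>i\<le>j. s i)" .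
  then show ?thesis
    by (simp add: k lessThan_Suc_atMost)
qed

text \<open>A permutation leaves the total colength unchanged, so the bound on partial sums applies
  to every summand of the weight.\<close>

lemma weight_bigo_ge_3:
  assumes "length \<mu>s \<ge> 3" "\<forall>\<mu>\<in>set \<mu>s. colength \<mu> \<noteq> 0"
  shows "(\<lambda>q. weight q \<mu>s) \<in> O[at_right 0](\<lambda>q. q ^ (sum_list (map colength \<mu>s) + 2))"
proof -
  let ?k = "length \<mu>s"
  have *: "(\<lambda>q. \<Prod>j<?k. geom (\<Sum>i\<le>j. colength (\<mu>s ! \<sigma> i)) q)
      \<in> O[at_right 0](\<lambda>q. q ^ (sum_list (map colength \<mu>s) + 2))"
    if \<sigma>: "\<sigma> permutes {..<?k}" for \<sigma>
  proof (rule bigo_power_weaken[OF prod_geom_bigo])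
    have pos: "colength (\<mu>s ! \<sigma> i) \<ge> 1" if "i < ?k" for i
      using assms(2) that permutes_in_image[OF \<sigma>, of i] by (auto simp: Suc_le_eq)
    show "1 \<le> (\<Sum>i\<le>j. colength (\<mu>s ! \<sigma> i))" if "j \<in> {..<?k}" for j
      using pos[of j] that member_le_sum[of j "{..j}" "\<lambda>i. colength (\<mu>s ! \<sigma> i)"] by auto
    have "sum_list (map colength \<mu>s) = (\<Sum>i<?k. colength (\<mu>s ! i))"
      by (simp add: sum_list_sum_nth atLeast0LessThan)
    also have "\<dots> = (\<Sum>i<?k. colength (\<mu>s ! \<sigma> i))"
      using sum.permute[OF \<sigma>, of "\<lambda>i. colength (\<mu>s ! i)"] by (simp add: o_def)
    finally show "sum_list (map colength \<mu>s) + 2 \<le> (\<Sum>j<?k. \<Sum>i\<le>j. colength (\<mu>s ! \<sigma> i))"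
      using partial_sums_lower_bound[of ?k "\<lambda>i. colength (\<mu>s ! \<sigma> i)"] pos assms(1) by simp
  qed simp
  show ?thesis
    unfolding weight_def geom_def[symmetric]
    \<comment> \<open>The factor \<open>1 / aut_card\<close> does not depend on \<open>q\<close>,
      hence is bounded by a multiple of 1.\<close>
    by (rule landau_o.big.mult[where ?g1.0 = "\<lambda>_. 1", simplified mult_1, OF bigo_const big_sum_in_bigo])
       (use * in auto)
qed

text \<open>The part of the weight of order at most \<open>d + 1\<close> in \<open>q\<close>.\<close>

definition lead :: "nat \<Rightarrow> real \<Rightarrow> nat multiset list \<Rightarrow> real" where
  "lead d q \<mu>s = (if length \<mu>s = 1 then q ^ d
     else if length \<mu>s = 2 \<and> colength (\<mu>s ! 1) = 1 then q ^ (d + 1) else 0)"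

section \<open>Comparison of each weight with its leading part\<close>

lemma weight_minus_lead_bigo:
  assumes \<mu>s: "\<mu>s \<in> tuples n d k" "colength_decreasing \<mu>s" and "d \<ge> 2" "k \<ge> 1"
  shows "(\<lambda>q. weight q \<mu>s - lead d q \<mu>s) \<in> O[at_right 0](\<lambda>q. q ^ (d + 2))"
proof -
  have \<mu>s': "length \<mu>s = k" "\<forall>\<mu>\<in>set \<mu>s. colength \<mu> \<noteq> 0" "sum_list (map colength \<mu>s) = d"
    using \<mu>s by (auto simp: tuples_def)
  consider "k = 1" | "k = 2" | "k \<ge> 3" using \<open>k \<ge> 1\<close> by linarith
  then show ?thesis
  proof cases
    case 1
    then obtain \<mu> where "\<mu>s = [\<mu>]" "colength \<mu> = d"
      using \<mu>s' by (auto simp: length_Suc_conv)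
    then show ?thesis
      \<comment> \<open>The error has order \<open>2 * d\<close>, which is at least
        \<open>d + 2\<close> because \<open>d \<ge> 2\<close>.\<close>
      using bigo_power_weaken[OF geom_minus_power_bigo[of d], of "d + 2"] \<open>d \<ge> 2\<close>
      by (simp add: weight_singleton lead_def)
  next
    case 2
    then obtain \<mu> \<nu> where eq: "\<mu>s = [\<mu>, \<nu>]"
      using \<mu>s' by (auto simp: length_Suc_conv numeral_2_eq_2)
    define a b where "a = colength \<mu>" and "b = colength \<nu>"
    \<comment> \<open>Decreasing order puts the smaller colength second, which is why
      \<open>lead\<close> tests only the second entry for colength 1.\<close>
    have ab: "a + b = d" "a \<ge> b" "b \<ge> 1"
      using \<mu>s' \<mu>s(2) by (auto simp: eq a_def b_def colength_decreasing_def)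
    have w: "weight q \<mu>s = (if a = b then geom a q * geom d q
        else geom a q * geom d q + geom b q * geom d q)" for q
      using ab(1) by (simp only: eq weight_pair a_def b_def)
    \<comment> \<open>The rearrangement starting with \<open>c\<close> has partial sums
      \<open>c\<close> and \<open>d\<close>, so \<open>c \<ge> 2\<close> already makes it
      negligible.\<close>
    have large: "(\<lambda>q. geom c q * geom d q) \<in> O[at_right 0](\<lambda>q. q ^ (d + 2))" if "c \<ge> 2" for c
    proof -
      have "(\<lambda>q. geom c q * geom d q) \<in> O[at_right 0](\<lambda>q. q ^ c * q ^ d)"
        using that \<open>d \<ge> 2\<close> by (intro landau_o.big.mult geom_bigo) auto
      then have "(\<lambda>q. geom c q * geom d q) \<in> O[at_right 0](\<lambda>q. q ^ (c + d))"
        unfolding power_add .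
      then show ?thesis
        by (rule bigo_power_weaken) (use that in simp)
    qed
    show ?thesis
    proof (cases "b = 1")
      case True
      then have l: "lead d q \<mu>s = q ^ (d + 1)" for q
        by (simp add: lead_def eq b_def)
      have small: "(\<lambda>q. geom 1 q * geom d q - q ^ (d + 1)) \<in> O[at_right 0](\<lambda>q. q ^ (d + 2))"
        using \<open>d \<ge> 2\<close> by (intro geom_mult_geom_minus_power_bigo) auto
      show ?thesis
      proof (cases "a = 1")
        \<comment> \<open>Here \<open>d = 2\<close>, and \<open>weight_pair\<close> leaves a single
          product.\<close>
        case a1: True
        with True have "weight q \<mu>s - lead d q \<mu>s = geom 1 q * geom d q - q ^ (d + 1)" for q
          by (simp only: w l simp_thms if_True)
        then show ?thesis
          by (simp only: small)
      next
        case False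
        then have "a \<ge> 2" using ab by simp
        have "weight q \<mu>s - lead d q \<mu>s
            = geom a q * geom d q + (geom 1 q * geom d q - q ^ (d + 1))" for q
          using True False by (simp add: w l)
        then show ?thesis
          by (simp only: sum_in_bigo(1)[OF large[OF \<open>a \<ge> 2\<close>] small])
      qed
    next
      case False
      then have "lead d q \<mu>s = 0" for q
        by (simp add: lead_def eq b_def)
      then have eq_w: "weight q \<mu>s - lead d q \<mu>s = weight q \<mu>s" for q
        by simp
      have "a \<ge> 2" "b \<ge> 2" using ab False by auto
      then have "(\<lambda>q. geom a q * geom d q) \<in> O[at_right 0](\<lambda>q. q ^ (d + 2))"
        "(\<lambda>q. geom a q * geom d q + geom b q * geom d q) \<in> O[at_right 0](\<lambda>q. q ^ (d + 2))"
        by - (intro sum_in_bigo(1) large; assumption)+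
      then show ?thesis
        unfolding eq_w unfolding w by (cases "a = b") (simp_all only: if_True if_False simp_thms)
    qed
  next
    case 3
    then show ?thesis
      using weight_bigo_ge_3[of \<mu>s] \<mu>s' by (simp add: lead_def)
  qed
qed

section \<open>Summation of the leading parts\<close>

lemma tuples_1:
  assumes "d \<ge> 1"
  shows "{\<mu>s \<in> tuples n d 1. colength_decreasing \<mu>s}
    = (\<lambda>\<mu>. [\<mu>]) ` {\<mu> \<in> partitions n. colength \<mu> = d}"
  using assms by (auto simp: tuples_def colength_decreasing_def length_Suc_conv)

text \<open>Since \<open>d - 1 \<ge> 1\<close>, such pairs are automatically in decreasing order and
  have nonzero colengths.\<close>

lemma tuples_2_last_1:
  assumes "d \<ge> 2"
  shows "{\<mu>s \<in> tuples n d 2. colength_decreasing \<mu>s \<and> colength (\<mu>s ! 1) = 1}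
    = (\<lambda>(\<mu>, \<nu>). [\<mu>, \<nu>]) ` ({\<mu> \<in> partitions n. colength \<mu> = d - 1}
        \<times> {\<mu> \<in> partitions n. colength \<mu> = 1})"
  using assms
  by (auto simp: tuples_def colength_decreasing_def length_Suc_conv numeral_2_eq_2 image_iff)

lemma sum_lead:
  fixes g :: "nat multiset list \<Rightarrow> real"
  assumes "d \<ge> 2"
  shows "(\<Sum>k=1..d. \<Sum>\<mu>s\<in>{\<mu>s \<in> tuples n d k. colength_decreasing \<mu>s}. g \<mu>s * lead d q \<mu>s)
    = q ^ d * (\<Sum>\<mu> | \<mu> \<in> partitions n \<and> colength \<mu> = d. g [\<mu>])
      + q ^ (d + 1) *
        (\<Sum>(\<mu>1, \<mu>2) \<in> {\<mu> \<in> partitions n. colength \<mu> = d - 1} \<times>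
                      {\<mu> \<in> partitions n. colength \<mu> = 1}. g [\<mu>1, \<mu>2])"
proof -
  define S where "S k = (\<Sum>\<mu>s\<in>{\<mu>s \<in> tuples n d k. colength_decreasing \<mu>s}. g \<mu>s * lead d q \<mu>s)" for k
  have "S k = 0" if "k \<notin> {1, 2}" for k
    unfolding S_def using that by (intro sum.neutral) (auto simp: length_tuples lead_def)
  \<comment> \<open>Both 1 and 2 lie in the range of \<open>k\<close> because
    \<open>d \<ge> 2\<close>.\<close>
  then have "(\<Sum>k=1..d. S k) = (\<Sum>k\<in>{1,2}. S k)"
    using assms by (intro sum.mono_neutral_right) auto
  also have "\<dots> = S 1 + S 2" by simp
  also have "S 1 = q ^ d * (\<Sum>\<mu> | \<mu> \<in> partitions n \<and> colength \<mu> = d. g [\<mu>])"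
    using assms unfolding S_def
    by (subst tuples_1)
       (auto simp: sum.reindex inj_on_def lead_def sum_distrib_left mult_ac)
  \<comment> \<open>On the discarded pairs the second colength differs from 1, so
    \<open>lead\<close> vanishes.\<close>
  also have "S 2 = (\<Sum>\<mu>s\<in>{\<mu>s \<in> tuples n d 2. colength_decreasing \<mu>s \<and> colength (\<mu>s ! 1) = 1}.
      g \<mu>s * q ^ (d + 1))"
    unfolding S_def
    by (rule sum.mono_neutral_cong_right)
       (auto simp: lead_def finite_tuples length_tuples)
  also have "\<dots> = q ^ (d + 1) *
        (\<Sum>(\<mu>1, \<mu>2) \<in> {\<mu> \<in> partitions n. colength \<mu> = d - 1} \<times>
                      {\<mu> \<in> partitions n. colength \<mu> = 1}. g [\<mu>1, \<mu>2])"
    unfolding tuples_2_last_1[OF assms]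
    by (subst sum.reindex)
       (auto simp: inj_on_def sum_distrib_left mult_ac case_prod_unfold)
  finally show ?thesis unfolding S_def .
qed

theorem theorem3p3:
  fixes d n :: nat and g :: "nat multiset list \<Rightarrow> real"
  assumes "d \<ge> 2" and "n \<ge> 2 * d"
  shows "(\<lambda>q::real.
      (\<Sum>k=1..d. \<Sum>\<mu>s\<in>{\<mu>s \<in> tuples n d k. colength_decreasing \<mu>s}. g \<mu>s * weight q \<mu>s)
      - (q ^ d * (\<Sum>\<mu> | \<mu> \<in> partitions n \<and> colength \<mu> = d. g [\<mu>])
         + q ^ (d + 1) *
           (\<Sum>(\<mu>1, \<mu>2) \<in> {\<mu> \<in> partitions n. colength \<mu> = d - 1} \<times>
                         {\<mu> \<in> partitions n. colength \<mu> = 1}. g [\<mu>1, \<mu>2])))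
    \<in> O[at_right 0](\<lambda>q. q ^ (d + 2))"
proof -
  \<comment> \<open>The values of \<open>g\<close> and the index sets do not depend on
    \<open>q\<close>, so the bounds for single tuples add up.\<close>
  have "(\<lambda>q. \<Sum>k=1..d. \<Sum>\<mu>s\<in>{\<mu>s \<in> tuples n d k. colength_decreasing \<mu>s}.
      g \<mu>s * (weight q \<mu>s - lead d q \<mu>s)) \<in> O[at_right 0](\<lambda>q. q ^ (d + 2))"
    using weight_minus_lead_bigo assms(1) by (intro big_sum_in_bigo) auto
  then show ?thesis
    \<comment> \<open>Read backwards, \<open>sum_lead\<close> spreads the two main terms over the
      same tuples as the weights, and the difference can be taken termwise.\<close>
    unfolding sum_lead[OF assms(1), symmetric]
    by (simp add: right_diff_distrib sum_subtractf)
qed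

end
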